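(* Let $\alpha\in\mathbb R$ not be an integer multiple of $\pi$, and let $\phi\in L^2(\mathbb R)$. Suppose that the system $\{\phi(t-n)e^{-i(tn+n^2)\cot\alpha} : n\in\mathbb Z\}$ forms a Riesz basis of its closed linear span $V_0^\alpha\subseteq L^2(\mathbb R)$. Then there is a function $\varphi$ such that $\{\varphi(t-n)e^{-i(tn+n^2)\cot\alpha} : n\in\mathbb Z\}$ forms an orthonormal basis for $V_0^\alpha$.
   Context: Here $i$ is the imaginary unit and functions are complex-valued functions of $t\in\mathbb R$. A system $\{f_k : k\in\mathbb Z\}$ of functions in $L^2(\mathbb R)$ is a Riesz basis of a closed subspace $\mathcal H$ of $L^2(\mathbb R)$ (to which the $f_k$ belong) if for any $f\in\mathcal H$ there is a sequence $\{a[k]\}_{k\in\mathbb Z}\in\ell^2(\mathbb Z)$ such that $f=\sum_{k\in\mathbb Z}a[k]f_k$ with convergence in $L^2(\mathbb R)$, and $$C_1\sum_{k\in\mathbb Z}|a[k]|^2\le\Big\|\sum_{k\in\mathbb Z}a[k]f_k\Big\|_2^2\le C_2\sum_{k\in\mathbb Z}|a[k]|^2,$$ where the constants $0<C_1\le C_2<\infty$ are independent of $f$. *)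

theory Defs
  imports "HOL-Analysis.Analysis"
begin

text \<open>
  Elements of \<open>L\<^sup>2(\<real>)\<close> are represented by functions, not by classes modulo equality almost
  everywhere. Closed subspaces in the sense below are closed under equality almost everywhere,
  so equality of such sets of functions is equality of the corresponding subspaces.
\<close>

definition L2 :: "(real \<Rightarrow> complex) set" where
  "L2 = {f. f \<in> borel_measurable lebesgue \<and> integrable lebesgue (\<lambda>t. (cmod (f t))\<^sup>2)}"

definition L2_inner :: "(real \<Rightarrow> complex) \<Rightarrow> (real \<Rightarrow> complex) \<Rightarrow> complex" where
  "L2_inner f g = (LINT t|lebesgue. f t * cnj (g t))"

definition L2_norm :: "(real \<Rightarrow> complex) \<Rightarrow> real" where
  "L2_norm f = sqrt (LINT t|lebesgue. (cmod (f t))\<^sup>2)"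

definition closed_subspace_L2 :: "(real \<Rightarrow> complex) set \<Rightarrow> bool" where
  "closed_subspace_L2 H \<longleftrightarrow>
     H \<subseteq> L2 \<and> (\<lambda>t. 0) \<in> H \<and>
     (\<forall>f\<in>H. \<forall>g\<in>H. (\<lambda>t. f t + g t) \<in> H) \<and>
     (\<forall>c. \<forall>f\<in>H. (\<lambda>t. c * f t) \<in> H) \<and>
     (\<forall>g\<in>L2. (\<forall>\<epsilon>>0. \<exists>h\<in>H. L2_norm (\<lambda>t. g t - h t) < \<epsilon>) \<longrightarrow> g \<in> H)"

definition closed_span_L2 :: "(int \<Rightarrow> real \<Rightarrow> complex) \<Rightarrow> (real \<Rightarrow> complex) set" where
  "closed_span_L2 f =
     {g \<in> L2. \<forall>\<epsilon>>0. \<exists>F c. finite F \<and> L2_norm (\<lambda>t. g t - (\<Sum>k\<in>F. c k * f k t)) < \<epsilon>}"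

definition has_sum_L2 ::
  "(int \<Rightarrow> real \<Rightarrow> complex) \<Rightarrow> (real \<Rightarrow> complex) \<Rightarrow> bool" where
  "has_sum_L2 f g \<longleftrightarrow>
     ((\<lambda>F. L2_norm (\<lambda>t. g t - (\<Sum>k\<in>F. f k t))) \<longlongrightarrow> 0) (finite_subsets_at_top UNIV)"

definition l2 :: "(int \<Rightarrow> complex) set" where
  "l2 = {a. (\<lambda>k. (cmod (a k))\<^sup>2) summable_on UNIV}"

text \<open>
  The two-sided estimate is required of every square-summable expansion, not just of one
  expansion per element: the latter would also admit overcomplete frames. Uniqueness of the
  expansion follows from the lower estimate.
\<close>

definition Riesz_basis ::
  "(int \<Rightarrow> real \<Rightarrow> complex) \<Rightarrow> (real \<Rightarrow> complex) set \<Rightarrow> bool" where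
  "Riesz_basis f H \<longleftrightarrow>
     closed_subspace_L2 H \<and> (\<forall>k. f k \<in> H) \<and>
     (\<forall>g\<in>H. \<exists>a\<in>l2. has_sum_L2 (\<lambda>k t. a k * f k t) g) \<and>
     (\<exists>C\<^sub>1 C\<^sub>2. 0 < C\<^sub>1 \<and> C\<^sub>1 \<le> C\<^sub>2 \<and>
        (\<forall>g\<in>H. \<forall>a\<in>l2. has_sum_L2 (\<lambda>k t. a k * f k t) g \<longrightarrow>
           C\<^sub>1 * (\<Sum>\<^sub>\<infinity>k. (cmod (a k))\<^sup>2) \<le> (L2_norm g)\<^sup>2 \<and>
           (L2_norm g)\<^sup>2 \<le> C\<^sub>2 * (\<Sum>\<^sub>\<infinity>k. (cmod (a k))\<^sup>2)))"

definition orthonormal_basis_L2 ::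
  "(int \<Rightarrow> real \<Rightarrow> complex) \<Rightarrow> (real \<Rightarrow> complex) set \<Rightarrow> bool" where
  "orthonormal_basis_L2 f H \<longleftrightarrow>
     (\<forall>k. f k \<in> L2) \<and>
     (\<forall>j k. L2_inner (f j) (f k) = (if j = k then 1 else 0)) \<and>
     closed_span_L2 f = H"

definition chirp_shift :: "real \<Rightarrow> (real \<Rightarrow> complex) \<Rightarrow> int \<Rightarrow> real \<Rightarrow> complex" where
  "chirp_shift \<alpha> \<phi> n t =
     \<phi> (t - of_int n) *
     exp (- \<i> * complex_of_real ((t * of_int n + (of_int n)\<^sup>2) * cot \<alpha>))"

end

theory Submission imports Defs begin

text \<open>
  The argument is a Wold decomposition. Let \<open>U\<^sub>n\<close> denote the chirped shift by \<open>n\<close>; it is an isometry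
  of \<open>L\<^sup>2\<close>, and \<open>U\<^sub>m U\<^sub>n\<close> agrees with \<open>U\<close> at \<open>m + n\<close> up to a unimodular constant. Let \<open>V\<^sub>n\<close> be the
  closed span of the \<open>U\<^sub>k \<phi>\<close> with \<open>k \<ge> n\<close>, so that \<open>U\<^sub>m\<close> maps \<open>V\<^sub>n\<close> into the space with index \<open>m + n\<close>.
  By the lower Riesz bound \<open>\<phi>\<close> is not in \<open>V\<^sub>1\<close>; let \<open>\<psi>\<close> be the normalized component of \<open>\<phi>\<close>
  orthogonal to \<open>V\<^sub>1\<close>. The \<open>U\<^sub>n \<psi>\<close> are orthonormal, and each \<open>V\<^sub>n\<close> is the orthogonal sum of the line
  through \<open>U\<^sub>n \<psi>\<close> and the next space. Hence the component of \<open>\<phi>\<close> orthogonal to all \<open>U\<^sub>n \<psi>\<close>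
  with \<open>n \<ge> 0\<close> lies in every \<open>V\<^sub>n\<close>. The Riesz bounds force the intersection of the \<open>V\<^sub>n\<close> to be
  zero, so \<open>\<phi>\<close> is in the closed span of the \<open>U\<^sub>n \<psi>\<close>.
\<close>

section \<open>Inner product calculus on square-integrable functions\<close>

lemma L2_measurable: "f \<in> L2 \<Longrightarrow> f \<in> borel_measurable lebesgue"
  by (simp add: L2_def)

lemma L2_integrable: "f \<in> L2 \<Longrightarrow> integrable lebesgue (\<lambda>t. (cmod (f t))\<^sup>2)"
  by (simp add: L2_def)

lemma L2_zero: "(\<lambda>t. 0) \<in> L2"
  by (simp add: L2_def)

lemma L2_scale:
  assumes "f \<in> L2" shows "(\<lambda>t. c * f t) \<in> L2"
  using assms by (auto simp: L2_def norm_mult power_mult_distrib)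

lemma L2_add:
  assumes "f \<in> L2" "g \<in> L2" shows "(\<lambda>t. f t + g t) \<in> L2"
proof -
  note [measurable] = assms[THEN L2_measurable]
  have *: "(cmod (x + y))\<^sup>2 \<le> 2 * (cmod x)\<^sup>2 + 2 * (cmod y)\<^sup>2" for x y :: complex
    using power_mono[OF norm_triangle_ineq[of x y], of 2] sum_squares_bound[of "cmod x" "cmod y"]
    by (simp add: power2_sum)
  have "integrable lebesgue (\<lambda>t. (cmod (f t + g t))\<^sup>2)"
    by (rule Bochner_Integration.integrable_bound
          [where f = "\<lambda>t. 2 * (cmod (f t))\<^sup>2 + 2 * (cmod (g t))\<^sup>2"])
       (use * in \<open>auto intro!: AE_I2 Bochner_Integration.integrable_add integrable_mult_right assms[THEN L2_integrable]\<close>)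
  then show ?thesis by (simp add: L2_def)
qed

lemma L2_diff:
  assumes "f \<in> L2" "g \<in> L2" shows "(\<lambda>t. f t - g t) \<in> L2"
  using L2_add[OF assms(1) L2_scale[OF assms(2), of "-1"]] by simp

lemma L2_sum:
  assumes "\<And>k. k \<in> F \<Longrightarrow> f k \<in> L2" shows "(\<lambda>t. \<Sum>k\<in>F. c k * f k t) \<in> L2"
  using assms by (induction F rule: infinite_finite_induct) (auto intro!: L2_zero L2_add L2_scale)

lemma L2_integrable_mult:
  assumes "f \<in> L2" "g \<in> L2" shows "integrable lebesgue (\<lambda>t. f t * cnj (g t))"
proof -
  note [measurable] = assms[THEN L2_measurable]
  have [measurable]: "(\<lambda>t. cnj (g t)) \<in> borel_measurable lebesgue"
    by (rule measurable_compose[OF assms(2)[THEN L2_measurable] borel_measurable_continuous_onI])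
       (intro continuous_intros)
  have *: "cmod x * cmod y \<le> (cmod x)\<^sup>2 + (cmod y)\<^sup>2" for x y :: complex
    using sum_squares_bound[of "cmod x" "cmod y"] mult_nonneg_nonneg[OF norm_ge_zero[of x] norm_ge_zero[of y]]
    by linarith
  show ?thesis
    by (rule Bochner_Integration.integrable_bound
          [where f = "\<lambda>t. (cmod (f t))\<^sup>2 + (cmod (g t))\<^sup>2"])
       (use * in \<open>auto intro!: AE_I2 Bochner_Integration.integrable_add assms[THEN L2_integrable] simp: norm_mult\<close>)
qed

lemma L2_inner_add_left:
  assumes "f \<in> L2" "g \<in> L2" "h \<in> L2"
  shows "L2_inner (\<lambda>t. f t + g t) h = L2_inner f h + L2_inner g h"
  using assms by (simp add: L2_inner_def distrib_right L2_integrable_mult)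

lemma L2_inner_diff_left:
  assumes "f \<in> L2" "g \<in> L2" "h \<in> L2"
  shows "L2_inner (\<lambda>t. f t - g t) h = L2_inner f h - L2_inner g h"
  using assms by (simp add: L2_inner_def left_diff_distrib L2_integrable_mult)

lemma L2_inner_scale_left: "L2_inner (\<lambda>t. c * f t) h = c * L2_inner f h"
  by (simp add: L2_inner_def mult.assoc)

lemma L2_inner_commute: "L2_inner g f = cnj (L2_inner f g)"
  by (simp add: L2_inner_def mult.commute flip: Bochner_Integration.integral_cnj)

lemma L2_inner_scale_right: "L2_inner f (\<lambda>t. c * g t) = cnj c * L2_inner f g"
  by (metis L2_inner_commute L2_inner_scale_left complex_cnj_mult)

lemma L2_inner_diff_right:
  assumes "f \<in> L2" "g \<in> L2" "h \<in> L2"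
  shows "L2_inner h (\<lambda>t. f t - g t) = L2_inner h f - L2_inner h g"
  by (metis assms L2_inner_commute L2_inner_diff_left complex_cnj_diff)

lemma L2_inner_self: "L2_inner f f = of_real ((L2_norm f)\<^sup>2)"
proof -
  have "L2_inner f f = (LINT t|lebesgue. complex_of_real ((cmod (f t))\<^sup>2))"
    by (simp add: L2_inner_def complex_norm_square[symmetric] del: of_real_power)
  then show ?thesis
    by (simp add: L2_norm_def del: of_real_power)
qed

lemma L2_norm_nonneg: "0 \<le> L2_norm f"
  by (simp add: L2_norm_def)

lemma L2_norm_zero: "L2_norm (\<lambda>t. 0) = 0"
  by (simp add: L2_norm_def)

lemma L2_norm_scale: "L2_norm (\<lambda>t. c * f t) = cmod c * L2_norm f"
  by (simp add: L2_norm_def norm_mult power_mult_distrib real_sqrt_mult)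

lemma L2_norm_minus_commute: "L2_norm (\<lambda>t. f t - g t) = L2_norm (\<lambda>t. g t - f t)"
  by (simp add: L2_norm_def norm_minus_commute)

lemma L2_norm_diff_sq:
  assumes "f \<in> L2" "g \<in> L2"
  shows "(L2_norm (\<lambda>t. f t - g t))\<^sup>2 = (L2_norm f)\<^sup>2 + (L2_norm g)\<^sup>2 - 2 * Re (L2_inner f g)"
proof -
  have "of_real ((L2_norm (\<lambda>t. f t - g t))\<^sup>2) =
      L2_inner f f + L2_inner g g - (L2_inner f g + cnj (L2_inner f g))"
    unfolding L2_inner_self[symmetric] using assms
    by (simp add: L2_inner_diff_left L2_inner_diff_right L2_diff L2_inner_commute[of g f])
  then show ?thesis
    unfolding complex_add_cnj L2_inner_self of_real_add[symmetric] of_real_diff[symmetric] of_real_eq_iff .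
qed

text \<open>Norm zero only means zero almost everywhere, and this passes to the integrand. It
  settles the degenerate cases in which division by \<open>L2_norm g\<close> is impossible.\<close>

lemma L2_inner_zero_if_norm_zero:
  assumes "f \<in> L2" "g \<in> L2" "L2_norm g = 0"
  shows "L2_inner f g = 0"
proof -
  have "AE t in lebesgue. (cmod (g t))\<^sup>2 = 0"
    using integral_nonneg_eq_0_iff_AE[OF L2_integrable[OF assms(2)]] assms(3)
    by (simp add: L2_norm_def)
  then have "AE t in lebesgue. f t * cnj (g t) = 0"
    by auto
  then show ?thesis
    unfolding L2_inner_def by (rule integral_eq_zero_AE)
qed

text \<open>Pythagoras for the component of \<open>f\<close> along \<open>g\<close>. Nonnegativity
  of the left side gives Cauchy-Schwarz; the exact decrease shows later that the residual at a
  nearest point is orthogonal.\<close>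

lemma L2_norm_diff_projection_sq:
  assumes "f \<in> L2" "g \<in> L2" "L2_norm g \<noteq> 0"
  shows "(L2_norm (\<lambda>t. f t - L2_inner f g / of_real ((L2_norm g)\<^sup>2) * g t))\<^sup>2 =
    (L2_norm f)\<^sup>2 - (cmod (L2_inner f g))\<^sup>2 / (L2_norm g)\<^sup>2"
proof -
  define n where "n = (L2_norm g)\<^sup>2"
  have n: "n > 0" using assms(3) by (simp add: n_def)
  define z where "z = L2_inner f g"
  define c where "c = z / of_real n"
  have "(L2_norm (\<lambda>t. f t - c * g t))\<^sup>2 = (L2_norm f)\<^sup>2 + (cmod c)\<^sup>2 * n - 2 * Re (cnj c * z)"
    using assms by (simp add: L2_norm_diff_sq L2_scale L2_norm_scale L2_inner_scale_right power_mult_distrib n_def z_def)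
  also have "cnj c * z = of_real ((cmod z)\<^sup>2 / n)"
    unfolding c_def of_real_divide complex_norm_square by (simp add: mult.commute)
  also have "(cmod c)\<^sup>2 * n = (cmod z)\<^sup>2 / n"
    using n by (simp add: c_def norm_divide power_divide power2_eq_square)
  finally show ?thesis by (simp add: c_def z_def n_def)
qed

lemma Cauchy_Schwarz_L2:
  assumes "f \<in> L2" "g \<in> L2"
  shows "cmod (L2_inner f g) \<le> L2_norm f * L2_norm g"
proof (cases "L2_norm g = 0")
  case True
  then show ?thesis using L2_inner_zero_if_norm_zero[OF assms] by simp
next
  case False
  then have "(cmod (L2_inner f g))\<^sup>2 / (L2_norm g)\<^sup>2 \<le> (L2_norm f)\<^sup>2"
    using L2_norm_diff_projection_sq[OF assms False]
      zero_le_power2[of "L2_norm (\<lambda>t. f t - L2_inner f g / of_real ((L2_norm g)\<^sup>2) * g t)"] by linarith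
  then have "(cmod (L2_inner f g))\<^sup>2 \<le> (L2_norm f * L2_norm g)\<^sup>2"
    using False by (simp add: divide_le_eq power_mult_distrib)
  then show ?thesis
    by (rule power2_le_imp_le) (simp add: L2_norm_nonneg)
qed

lemma L2_norm_triangle_diff:
  assumes "f \<in> L2" "g \<in> L2"
  shows "L2_norm (\<lambda>t. f t - g t) \<le> L2_norm f + L2_norm g"
proof (rule power2_le_imp_le)
  have "- Re (L2_inner f g) \<le> L2_norm f * L2_norm g"
    using Cauchy_Schwarz_L2[OF assms] abs_Re_le_cmod[of "L2_inner f g"] by linarith
  then show "(L2_norm (\<lambda>t. f t - g t))\<^sup>2 \<le> (L2_norm f + L2_norm g)\<^sup>2"
    unfolding L2_norm_diff_sq[OF assms] power2_sum by linarith
qed (simp add: L2_norm_nonneg)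

lemma L2_norm_triangle:
  assumes "f \<in> L2" "g \<in> L2"
  shows "L2_norm (\<lambda>t. f t + g t) \<le> L2_norm f + L2_norm g"
  using L2_norm_triangle_diff[OF assms(1) L2_scale[OF assms(2), of "-1"]] L2_norm_scale[of "-1" g] by simp

lemma L2_norm_triangle_through:
  assumes "f \<in> L2" "g \<in> L2" "h \<in> L2"
  shows "L2_norm (\<lambda>t. f t - h t) \<le> L2_norm (\<lambda>t. f t - g t) + L2_norm (\<lambda>t. g t - h t)"
  using L2_norm_triangle[OF L2_diff[OF assms(1,2)] L2_diff[OF assms(2,3)]] by simp

lemma parallelogram_L2:
  assumes "f \<in> L2" "g \<in> L2"
  shows "(L2_norm (\<lambda>t. f t + g t))\<^sup>2 + (L2_norm (\<lambda>t. f t - g t))\<^sup>2 =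
    2 * (L2_norm f)\<^sup>2 + 2 * (L2_norm g)\<^sup>2"
  using L2_norm_diff_sq[OF assms] L2_norm_diff_sq[OF assms(1) L2_scale[OF assms(2), of "-1"]]
    L2_norm_scale[of "-1" g] L2_inner_scale_right[of f "-1" g] by simp

section \<open>Completeness\<close>

lemma nn_integral_L2_norm:
  assumes "f \<in> L2"
  shows "(\<integral>\<^sup>+ t. ennreal ((cmod (f t))\<^sup>2) \<partial>lebesgue) = ennreal ((L2_norm f)\<^sup>2)"
  using assms by (subst nn_integral_eq_integral) (auto simp: L2_norm_def L2_def)

text \<open>Fatou's lemma yields only a bound on a nonnegative integral; its finiteness gives
  integrability, and with that both conclusions.\<close>

lemma L2_norm_le_nn_integral:
  assumes "f \<in> borel_measurable lebesgue" "0 \<le> B"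
    and "(\<integral>\<^sup>+ t. ennreal ((cmod (f t))\<^sup>2) \<partial>lebesgue) \<le> ennreal (B\<^sup>2)"
  shows "f \<in> L2" "L2_norm f \<le> B"
proof -
  note [measurable] = assms(1)
  have "integrable lebesgue (\<lambda>t. (cmod (f t))\<^sup>2)"
    using order.strict_trans1[OF assms(3) ennreal_less_top] by (intro integrableI_nonneg) auto
  then show "f \<in> L2" by (simp add: L2_def)
  from nn_integral_L2_norm[OF this] assms(3) have "(L2_norm f)\<^sup>2 \<le> B\<^sup>2"
    by simp
  then show "L2_norm f \<le> B"
    using assms(2) by (rule power2_le_imp_le)
qed

text \<open>
  Completeness, for sequences with geometric increments \<open>D\<^sub>n\<close>: finiteness of the integral of
  \<open>\<Sum>\<^sub>n 2\<^sup>n D\<^sub>n\<^sup>2\<close> and \<open>D\<^sub>n \<le> 2\<^sup>-\<^sup>n + 2\<^sup>n D\<^sub>n\<^sup>2\<close> give convergence almost everywhere.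
\<close>

lemma L2_complete_fast:
  fixes u :: "nat \<Rightarrow> real \<Rightarrow> complex"
  assumes u: "\<And>n. u n \<in> L2"
    and fast: "\<And>n. L2_norm (\<lambda>t. u (Suc n) t - u n t) \<le> (1/2)^n"
  obtains g where "g \<in> L2" "\<And>n. L2_norm (\<lambda>t. g t - u n t) \<le> 2 * (1/2)^n"
proof -
  note [measurable] = u[THEN L2_measurable]
  define D where "D n t = cmod (u (Suc n) t - u n t)" for n t
  have [measurable]: "D n \<in> borel_measurable lebesgue" for n
    unfolding D_def by measurable
  have D: "(\<integral>\<^sup>+ t. ennreal ((D n t)\<^sup>2) \<partial>lebesgue) \<le> ennreal ((1/4)^n)" for n
  proof -
    have "(\<integral>\<^sup>+ t. ennreal ((D n t)\<^sup>2) \<partial>lebesgue) = ennreal ((L2_norm (\<lambda>t. u (Suc n) t - u n t))\<^sup>2)"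
      unfolding D_def by (rule nn_integral_L2_norm[OF L2_diff[OF u u]])
    also have "\<dots> \<le> ennreal (((1/2)^n)\<^sup>2)"
      by (intro ennreal_leI power_mono fast L2_norm_nonneg)
    also have "((1/2::real)^n)\<^sup>2 = (1/4)^n"
      by (simp add: power_mult[symmetric] mult.commute power2_eq_square flip: power_mult_distrib)
    finally show ?thesis .
  qed
  have "(\<integral>\<^sup>+ t. (\<Sum>n. ennreal (2^n * (D n t)\<^sup>2)) \<partial>lebesgue) =
      (\<Sum>n. \<integral>\<^sup>+ t. ennreal (2^n * (D n t)\<^sup>2) \<partial>lebesgue)"
    by (rule nn_integral_suminf) measurable
  also have "\<dots> = (\<Sum>n. ennreal (2^n) * (\<integral>\<^sup>+ t. ennreal ((D n t)\<^sup>2) \<partial>lebesgue))"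
    by (simp add: ennreal_mult nn_integral_cmult)
  also have "\<dots> \<le> (\<Sum>n. ennreal (2^n) * ennreal ((1/4)^n))"
    by (intro suminf_le mult_left_mono D) auto
  also have "\<dots> = (\<Sum>n. ennreal ((1/2)^n))"
    by (simp add: ennreal_mult[symmetric] flip: power_mult_distrib)
  also have "\<dots> = ennreal (\<Sum>n. (1/2)^n)"
    by (intro suminf_ennreal2) auto
  also have "\<dots> < \<infinity>" by simp
  finally have "(\<integral>\<^sup>+ t. (\<Sum>n. ennreal (2^n * (D n t)\<^sup>2)) \<partial>lebesgue) \<noteq> \<infinity>" by simp
  then have "AE t in lebesgue. (\<Sum>n. ennreal (2^n * (D n t)\<^sup>2)) \<noteq> \<infinity>"
    by (intro nn_integral_PInf_AE) auto
  then have conv: "AE t in lebesgue. convergent (\<lambda>n. u n t)"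
  proof eventually_elim
    case (elim t)
    then have s: "summable (\<lambda>n. 2^n * (D n t)\<^sup>2)"
      by (intro summable_suminf_not_top) auto
    have "D n t \<le> (1/2)^n + 2^n * (D n t)\<^sup>2" for n
    proof (cases "D n t \<le> (1/2)^n")
      case False
      then have "1 \<le> 2^n * D n t" by (simp add: field_simps)
      then have "1 * D n t \<le> 2^n * D n t * D n t"
        by (intro mult_right_mono) (auto simp: D_def)
      then have "D n t \<le> 2^n * (D n t)\<^sup>2" by (simp add: power2_eq_square mult.assoc)
      then show ?thesis by (rule add_increasing[rotated]) simp
    qed (simp add: add_increasing2)
    note bound = this
    have "summable (\<lambda>n. (1/2)^n + 2^n * (D n t)\<^sup>2)"
      by (rule summable_add[OF _ s]) simp
    then have "summable (\<lambda>n. u (Suc n) t - u n t)"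
      using bound unfolding D_def by (rule summable_comparison_test'[where N = 0])
    then have "convergent (\<lambda>n. u n t - u 0 t)"
      unfolding summable_iff_convergent sum_lessThan_telescope[of "\<lambda>n. u n t"] .
    from convergent_add[OF this convergent_const[of "u 0 t"]] show ?case by simp
  qed
  \<comment> \<open>\<open>lim\<close> has an unspecified value where the sequence diverges; by
    \<open>conv\<close> this happens only on a null set.\<close>
  define g where "g t = lim (\<lambda>n. u n t)" for t
  have [measurable]: "g \<in> borel_measurable lebesgue"
    unfolding g_def by measurable
  have near: "L2_norm (\<lambda>t. u (n + k) t - u n t) \<le> 2 * (1/2)^n" for n k
  proof -
    \<comment> \<open>The exact partial sum of the geometric series: the weaker bound
      \<open>2 * (1/2)^n\<close> does not carry through the induction.\<close>
    have "L2_norm (\<lambda>t. u (n + k) t - u n t) \<le> (2 - 2 * (1/2)^k) * (1/2)^n"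
    proof (induction k)
      case (Suc k)
      have "L2_norm (\<lambda>t. u (n + Suc k) t - u n t) \<le>
          L2_norm (\<lambda>t. u (n + Suc k) t - u (n + k) t) + L2_norm (\<lambda>t. u (n + k) t - u n t)"
        by (rule L2_norm_triangle_through[OF u u u])
      also have "\<dots> \<le> (1/2)^(n + k) + (2 - 2 * (1/2)^k) * (1/2)^n"
        using Suc fast[of "n + k"] by (intro add_mono) auto
      also have "\<dots> = (2 - 2 * (1/2)^Suc k) * (1/2)^n"
        by (simp add: power_add algebra_simps)
      finally show ?case .
    qed (simp add: L2_norm_zero)
    also have "\<dots> \<le> 2 * (1/2)^n"
      by (intro mult_right_mono) auto
    finally show ?thesis .
  qed
  \<comment> \<open>The bound \<open>near\<close> is uniform in \<open>k\<close>, so Fatou's lemma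
    transfers it to the limit.\<close>
  have fatou: "(\<integral>\<^sup>+ t. ennreal ((cmod (g t - u n t))\<^sup>2) \<partial>lebesgue) \<le> ennreal ((2 * (1/2)^n)\<^sup>2)" for n
  proof -
    have "(\<integral>\<^sup>+ t. ennreal ((cmod (g t - u n t))\<^sup>2) \<partial>lebesgue) =
        (\<integral>\<^sup>+ t. liminf (\<lambda>k. ennreal ((cmod (u (n + k) t - u n t))\<^sup>2)) \<partial>lebesgue)"
    proof (intro nn_integral_cong_AE)
      show "AE t in lebesgue. ennreal ((cmod (g t - u n t))\<^sup>2) =
          liminf (\<lambda>k. ennreal ((cmod (u (n + k) t - u n t))\<^sup>2))"
        using conv
      proof eventually_elim
        case (elim t)
        then have "(\<lambda>k. u k t) \<longlonglongrightarrow> g t"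
          by (simp add: g_def convergent_LIMSEQ_iff)
        then have "(\<lambda>k. u (k + n) t) \<longlonglongrightarrow> g t"
          by (rule LIMSEQ_ignore_initial_segment)
        then have "(\<lambda>k. u (n + k) t) \<longlonglongrightarrow> g t"
          by (simp add: add.commute)
        then have "(\<lambda>k. ennreal ((cmod (u (n + k) t - u n t))\<^sup>2)) \<longlonglongrightarrow> ennreal ((cmod (g t - u n t))\<^sup>2)"
          by (intro tendsto_intros)
        then show ?case
          by (intro lim_imp_Liminf[symmetric]) auto
      qed
    qed
    also have "\<dots> \<le> liminf (\<lambda>k. \<integral>\<^sup>+ t. ennreal ((cmod (u (n + k) t - u n t))\<^sup>2) \<partial>lebesgue)"
      by (intro nn_integral_liminf) measurable
    also have "\<dots> = liminf (\<lambda>k. ennreal ((L2_norm (\<lambda>t. u (n + k) t - u n t))\<^sup>2))"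
      by (simp add: nn_integral_L2_norm[OF L2_diff[OF u u]])
    also have "\<dots> \<le> liminf (\<lambda>k::nat. ennreal ((2 * (1/2)^n)\<^sup>2))"
      by (intro Liminf_mono always_eventually allI ennreal_leI power_mono near L2_norm_nonneg)
    also have "\<dots> = ennreal ((2 * (1/2)^n)\<^sup>2)"
      by (intro Liminf_const) auto
    finally show ?thesis .
  qed
  have gu: "(\<lambda>t. g t - u n t) \<in> L2" "L2_norm (\<lambda>t. g t - u n t) \<le> 2 * (1/2)^n" for n
    using L2_norm_le_nn_integral[OF _ _ fatou[of n]] by auto
  have "g \<in> L2"
    using L2_add[OF gu(1)[of 0] u[of 0]] by simp
  with gu(2) show ?thesis by (rule that[rotated])
qed

section \<open>Closed subspaces and orthogonal projection\<close>

lemma closed_subspace_add: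
  "closed_subspace_L2 H \<Longrightarrow> f \<in> H \<Longrightarrow> g \<in> H \<Longrightarrow> (\<lambda>t. f t + g t) \<in> H"
  by (simp add: closed_subspace_L2_def)

lemma closed_subspace_scale:
  "closed_subspace_L2 H \<Longrightarrow> f \<in> H \<Longrightarrow> (\<lambda>t. c * f t) \<in> H"
  by (simp add: closed_subspace_L2_def)

lemma closed_subspace_diff:
  "closed_subspace_L2 H \<Longrightarrow> f \<in> H \<Longrightarrow> g \<in> H \<Longrightarrow> (\<lambda>t. f t - g t) \<in> H"
  using closed_subspace_add[of H f "\<lambda>t. -1 * g t"] closed_subspace_scale[of H g "-1"] by simp

lemma closed_subspace_subset: "closed_subspace_L2 H \<Longrightarrow> f \<in> H \<Longrightarrow> f \<in> L2"
  by (auto simp: closed_subspace_L2_def)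

lemma closed_subspace_closed:
  assumes "closed_subspace_L2 H" "g \<in> L2" "\<And>\<epsilon>. \<epsilon> > 0 \<Longrightarrow> \<exists>h\<in>H. L2_norm (\<lambda>t. g t - h t) < \<epsilon>"
  shows "g \<in> H"
  using assms by (simp add: closed_subspace_L2_def)

lemma closed_subspace_sum:
  assumes "closed_subspace_L2 H" "\<And>k. k \<in> F \<Longrightarrow> f k \<in> H"
  shows "(\<lambda>t. \<Sum>k\<in>F. c k * f k t) \<in> H"
proof -
  have "(\<lambda>t. 0) \<in> H" using assms(1) by (simp add: closed_subspace_L2_def)
  with assms show ?thesis
    by (induction F rule: infinite_finite_induct)
       (auto intro!: closed_subspace_add closed_subspace_scale)
qed

text \<open>A bounded linear map is continuous, so it pulls closed subspaces back to closed
  subspaces. This reduces a claim about the image of a whole closed span to its generators.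
  Linearity is asked for on \<open>L2\<close> only, where \<open>L2_inner\<close> is known to be
  additive.\<close>

lemma closed_subspace_preimage:
  assumes H: "closed_subspace_L2 H"
    and T: "\<And>f. f \<in> L2 \<Longrightarrow> T f \<in> L2"
    and T_add: "\<And>f g. f \<in> L2 \<Longrightarrow> g \<in> L2 \<Longrightarrow> T (\<lambda>t. f t + g t) = (\<lambda>t. T f t + T g t)"
    and T_scale: "\<And>f c. f \<in> L2 \<Longrightarrow> T (\<lambda>t. c * f t) = (\<lambda>t. c * T f t)"
    and T_bound: "\<And>f. f \<in> L2 \<Longrightarrow> L2_norm (T f) \<le> K * L2_norm f"
  shows "closed_subspace_L2 {f \<in> L2. T f \<in> H}"
proof -
  have zero: "T (\<lambda>t. 0) = (\<lambda>t. 0)"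
    using T_scale[OF L2_zero, of 0] by simp
  have diff: "T (\<lambda>t. f t - g t) = (\<lambda>t. T f t - T g t)" if "f \<in> L2" "g \<in> L2" for f g
    using T_add[OF that(1) L2_scale[OF that(2), of "-1"]] T_scale[OF that(2), of "-1"] by simp
  have "g \<in> L2 \<and> T g \<in> H"
    if g: "g \<in> L2" and lim: "\<forall>\<epsilon>>0. \<exists>h\<in>{f \<in> L2. T f \<in> H}. L2_norm (\<lambda>t. g t - h t) < \<epsilon>" for g
  proof
    show "T g \<in> H"
    proof (rule closed_subspace_closed[OF H T[OF g]])
      fix \<epsilon> :: real assume "\<epsilon> > 0"
      \<comment> \<open>No sign of \<open>K\<close> is given; \<open>\<bar>K\<bar> + 1\<close> is a
        bound that is surely positive.\<close>
      then have pos: "\<epsilon> / (\<bar>K\<bar> + 1) > 0" by simp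
      obtain h where h: "h \<in> L2" "T h \<in> H" "L2_norm (\<lambda>t. g t - h t) < \<epsilon> / (\<bar>K\<bar> + 1)"
        using lim pos by blast
      have "L2_norm (\<lambda>t. T g t - T h t) \<le> K * L2_norm (\<lambda>t. g t - h t)"
        using T_bound[OF L2_diff[OF g h(1)]] by (simp add: diff[OF g h(1)])
      also have "\<dots> \<le> (\<bar>K\<bar> + 1) * L2_norm (\<lambda>t. g t - h t)"
        by (intro mult_right_mono L2_norm_nonneg) simp
      also have "\<dots> < \<epsilon>"
        using h(3) by (simp add: field_simps)
      finally show "\<exists>h\<in>H. L2_norm (\<lambda>t. T g t - h t) < \<epsilon>"
        using h(2) by blast
    qed
  qed (rule g)
  then show ?thesis
    using H unfolding closed_subspace_L2_def
    by (auto simp: zero T_add T_scale L2_zero intro!: L2_add L2_scale)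
qed

text \<open>A sequence minimizing the distance from \<open>f\<close> is Cauchy by the parallelogram
  law. Its limit is a nearest point of \<open>H\<close>, and the residual there is orthogonal to
  \<open>H\<close>.\<close>

lemma projection_L2:
  assumes H: "closed_subspace_L2 H" and f: "f \<in> L2"
  obtains p where "p \<in> H" "\<And>h. h \<in> H \<Longrightarrow> L2_inner (\<lambda>t. f t - p t) h = 0"
proof -
  define D where "D h = (L2_norm (\<lambda>t. f t - h t))\<^sup>2" for h
  define d where "d = (INF h\<in>H. D h)"
  have HL: "h \<in> L2" if "h \<in> H" for h
    using closed_subspace_subset[OF H that] .
  have ne: "H \<noteq> {}"
    using H by (auto simp: closed_subspace_L2_def)
  have bdd: "bdd_below (D ` H)"
    by (rule bdd_belowI[of _ 0]) (auto simp: D_def)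
  have d_le: "d \<le> D h" if "h \<in> H" for h
    unfolding d_def by (rule cINF_lower[OF bdd that])
  \<comment> \<open>With this slack the parallelogram law bounds the squared increment by
    \<open>(1/4)^n / 2 + (1/4)^n / 8\<close>, which is below the square of
    \<open>(1/2)^n\<close>.\<close>
  have "\<exists>h\<in>H. D h < d + (1/4)^n / 4" for n :: nat
    using cInf_lessD[of "D ` H" "d + (1/4)^n / 4"] ne by (auto simp: d_def)
  then obtain h where h: "h n \<in> H" "D (h n) < d + (1/4)^n / 4" for n :: nat
    by metis
  note hL = HL[OF h(1)]
  have fast: "L2_norm (\<lambda>t. h (Suc n) t - h n t) \<le> (1/2)^n" for n
  proof (rule power2_le_imp_le)
    let ?a = "\<lambda>t. f t - h n t" and ?b = "\<lambda>t. f t - h (Suc n) t"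
    let ?m = "\<lambda>t. 1/2 * (h n t + h (Suc n) t)"
    \<comment> \<open>The midpoint lies in \<open>H\<close>, so the sum of the two residuals has
      squared norm at least \<open>4 * d\<close>; the parallelogram law then leaves little for their
      difference.\<close>
    have "?m \<in> H"
      by (intro closed_subspace_scale[OF H] closed_subspace_add[OF H] h)
    then have "4 * d \<le> 4 * D ?m" using d_le by simp
    also have "\<dots> = (L2_norm (\<lambda>t. 2 * (f t - ?m t)))\<^sup>2"
      by (simp only: L2_norm_scale D_def power_mult_distrib) simp
    also have "(\<lambda>t. 2 * (f t - ?m t)) = (\<lambda>t. ?a t + ?b t)"
      by (auto simp: algebra_simps)
    finally have "4 * d + (L2_norm (\<lambda>t. ?a t - ?b t))\<^sup>2 \<le> 2 * D (h n) + 2 * D (h (Suc n))"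
      using parallelogram_L2[OF L2_diff[OF f hL[of n]] L2_diff[OF f hL[of "Suc n"]]]
      unfolding D_def by linarith
    moreover have D_Suc: "D (h (Suc n)) < d + (1/4)^n / 16"
      using h(2)[of "Suc n"] by simp
    ultimately have "(L2_norm (\<lambda>t. ?a t - ?b t))\<^sup>2 \<le> (1/4)^n"
      using h(2)[of n] D_Suc zero_le_power[of "1/4::real" n] by linarith
    then show "(L2_norm (\<lambda>t. h (Suc n) t - h n t))\<^sup>2 \<le> ((1/2)^n)\<^sup>2"
      by (simp add: power_mult[symmetric] mult.commute[of n] power_mult power_divide)
  qed simp
  obtain p where p: "p \<in> L2" "L2_norm (\<lambda>t. p t - h n t) \<le> 2 * (1/2)^n" for n
    using L2_complete_fast[OF hL fast] by blast
  have lim0: "(\<lambda>n. 2 * (1/2::real)^n) \<longlonglongrightarrow> 0"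
    by (rule tendsto_mult_right_zero) (simp add: LIMSEQ_power_zero)
  have pH: "p \<in> H"
  proof (rule closed_subspace_closed[OF H p(1)])
    fix \<epsilon> :: real assume "\<epsilon> > 0"
    with lim0 have "\<forall>\<^sub>F n in sequentially. 2 * (1/2::real)^n < \<epsilon>"
      by (rule order_tendstoD)
    then obtain n where "2 * (1/2::real)^n < \<epsilon>"
      by (auto simp: eventually_sequentially)
    with p(2)[of n] show "\<exists>h\<in>H. L2_norm (\<lambda>t. p t - h t) < \<epsilon>"
      using h(1)[of n] by (intro bexI[of _ "h n"]) auto
  qed
  \<comment> \<open>Both error terms vanish as \<open>n\<close> grows, so \<open>p\<close> attains
    the infimum.\<close>
  have "L2_norm (\<lambda>t. f t - p t) \<le> sqrt (d + (1/4)^n / 4) + 2 * (1/2)^n" for n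
  proof -
    have "L2_norm (\<lambda>t. f t - h n t) \<le> sqrt (d + (1/4)^n / 4)"
      using h(2)[of n] by (intro real_le_rsqrt) (simp add: D_def)
    moreover have "L2_norm (\<lambda>t. h n t - p t) \<le> 2 * (1/2)^n"
      using p(2)[of n] L2_norm_minus_commute[of p "h n"] by simp
    ultimately show ?thesis
      using L2_norm_triangle_through[OF f hL p(1), of n] by simp
  qed
  moreover have "(\<lambda>n. sqrt (d + (1/4)^n / 4) + 2 * (1/2)^n) \<longlonglongrightarrow> sqrt (d + 0 / 4) + 0"
    by (intro tendsto_intros lim0) (simp_all add: LIMSEQ_power_zero)
  ultimately have "L2_norm (\<lambda>t. f t - p t) \<le> sqrt d"
    using LIMSEQ_le_const by fastforce
  moreover have "0 \<le> d"
    unfolding d_def by (intro cINF_greatest ne) (simp add: D_def)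
  ultimately have min: "D p \<le> d"
    using power_mono[of "L2_norm (\<lambda>t. f t - p t)" "sqrt d" 2] by (simp add: D_def L2_norm_nonneg)
  have "L2_inner (\<lambda>t. f t - p t) g = 0" if g: "g \<in> H" for g
  proof (cases "L2_norm g = 0")
    case True
    then show ?thesis
      by (intro L2_inner_zero_if_norm_zero L2_diff f p HL g)
  next
    case False
    let ?z = "L2_inner (\<lambda>t. f t - p t) g"
    \<comment> \<open>Moving \<open>p\<close> by the \<open>g\<close>-component of the residual
      lowers the squared distance by \<open>(cmod ?z)\<^sup>2 / (L2_norm g)\<^sup>2\<close>, which
      minimality forces to be zero.\<close>
    let ?q = "\<lambda>t. p t + ?z / of_real ((L2_norm g)\<^sup>2) * g t"
    have "?q \<in> H"
      by (intro closed_subspace_add[OF H] closed_subspace_scale[OF H] pH g)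
    then have "D p \<le> D ?q"
      using d_le min by force
    also have "\<dots> = D p - (cmod ?z)\<^sup>2 / (L2_norm g)\<^sup>2"
      using L2_norm_diff_projection_sq[OF L2_diff[OF f p(1)] HL[OF g] False]
      by (simp add: D_def diff_diff_eq)
    finally show ?thesis
      using False by (simp add: divide_le_0_iff)
  qed
  with pH show ?thesis by (rule that)
qed

section \<open>Linear spans and their closures\<close>

definition lin_span :: "(int \<Rightarrow> real \<Rightarrow> complex) \<Rightarrow> int set \<Rightarrow> (real \<Rightarrow> complex) set" where
  "lin_span f I = {h. \<exists>F c. finite F \<and> F \<subseteq> I \<and> h = (\<lambda>t. \<Sum>k\<in>F. c k * f k t)}"

text \<open>The index set makes the tails \<open>{n..}\<close> of a system available; for
  \<open>UNIV\<close> this is \<open>closed_span_L2\<close>.\<close>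

definition closed_span_on :: "(int \<Rightarrow> real \<Rightarrow> complex) \<Rightarrow> int set \<Rightarrow> (real \<Rightarrow> complex) set" where
  "closed_span_on f I = {g \<in> L2. \<forall>\<epsilon>>0. \<exists>h\<in>lin_span f I. L2_norm (\<lambda>t. g t - h t) < \<epsilon>}"

lemma lin_spanI:
  assumes "finite F" "F \<subseteq> I" "\<And>t. h t = (\<Sum>k\<in>F. c k * f k t)"
  shows "h \<in> lin_span f I"
  unfolding lin_span_def mem_Collect_eq
  by (rule exI[of _ F], rule exI[of _ c]) (use assms in \<open>simp add: fun_eq_iff\<close>)

lemma lin_spanE:
  assumes "h \<in> lin_span f I"
  obtains F c where "finite F" "F \<subseteq> I" "h = (\<lambda>t. \<Sum>k\<in>F. c k * f k t)"
  using assms unfolding lin_span_def mem_Collect_eq by (elim exE conjE) (rule that)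

lemma bex_lin_span:
  "(\<exists>h\<in>lin_span f I. P h) \<longleftrightarrow> (\<exists>F c. finite F \<and> F \<subseteq> I \<and> P (\<lambda>t. \<Sum>k\<in>F. c k * f k t))"
  (is "?L \<longleftrightarrow> ?R")
proof
  assume ?L
  then show ?R by (elim bexE lin_spanE) blast
next
  assume ?R
  then show ?L by (elim exE conjE) (rule bexI, assumption, rule lin_spanI, auto)
qed

lemma closed_span_L2_eq: "closed_span_L2 f = closed_span_on f UNIV"
  by (simp add: closed_span_L2_def closed_span_on_def bex_lin_span)

text \<open>A closed subspace contains finite combinations of its elements, and then their limits.
  Every later inclusion of a span is checked on generators in this way.\<close>

lemma closed_span_on_minimal:
  assumes H: "closed_subspace_L2 H" and f: "\<And>k. k \<in> I \<Longrightarrow> f k \<in> H"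
  shows "closed_span_on f I \<subseteq> H"
proof
  fix g assume g: "g \<in> closed_span_on f I"
  have "lin_span f I \<subseteq> H"
    by (auto elim!: lin_spanE intro!: closed_subspace_sum[OF H] f)
  with g show "g \<in> H"
    by (intro closed_subspace_closed[OF H]) (auto simp: closed_span_on_def, blast)
qed

lemma lin_span_scale:
  assumes "g \<in> lin_span f I" shows "(\<lambda>t. c * g t) \<in> lin_span f I"
proof -
  obtain F d where F: "finite F" "F \<subseteq> I" "g = (\<lambda>t. \<Sum>k\<in>F. d k * f k t)"
    using assms by (rule lin_spanE)
  show ?thesis
    by (rule lin_spanI[OF F(1,2), of _ "\<lambda>k. c * d k"]) (simp add: F(3) sum_distrib_left mult.assoc)
qed

lemma sum_disjoint_if:
  fixes f :: "int \<Rightarrow> real \<Rightarrow> complex"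
  assumes "finite F" "finite G" "F \<inter> G = {}"
  shows "(\<Sum>k\<in>F \<union> G. (if k \<in> F then c k else d k) * f k t) =
    (\<Sum>k\<in>F. c k * f k t) + (\<Sum>k\<in>G. d k * f k t)"
proof -
  have "(\<Sum>k\<in>G. (if k \<in> F then c k else d k) * f k t) = (\<Sum>k\<in>G. d k * f k t)"
    using assms by (intro sum.cong) auto
  then show ?thesis
    using assms by (simp add: sum.union_disjoint)
qed

lemma lin_span_add:
  assumes "g \<in> lin_span f I" "h \<in> lin_span f I"
  shows "(\<lambda>t. g t + h t) \<in> lin_span f I"
proof -
  obtain F c where F: "finite F" "F \<subseteq> I" "g = (\<lambda>t. \<Sum>k\<in>F. c k * f k t)"
    using assms(1) by (rule lin_spanE)
  obtain G d where G: "finite G" "G \<subseteq> I" "h = (\<lambda>t. \<Sum>k\<in>G. d k * f k t)"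
    using assms(2) by (rule lin_spanE)
  have "g t + h t = (\<Sum>k\<in>F \<union> G. ((if k \<in> F then c k else 0) + (if k \<in> G then d k else 0)) * f k t)" for t
  proof -
    have "(\<Sum>k\<in>F. c k * f k t) = (\<Sum>k\<in>F \<union> G. (if k \<in> F then c k else 0) * f k t)"
      using F(1) G(1) by (intro sum.mono_neutral_cong_left) auto
    moreover have "(\<Sum>k\<in>G. d k * f k t) = (\<Sum>k\<in>F \<union> G. (if k \<in> G then d k else 0) * f k t)"
      using F(1) G(1) by (intro sum.mono_neutral_cong_left) auto
    ultimately show ?thesis
      by (simp add: F G distrib_right sum.distrib)
  qed
  then show ?thesis
    using F(1,2) G(1,2)
    by (intro lin_spanI[of "F \<union> G" _ _ "\<lambda>k. (if k \<in> F then c k else 0) + (if k \<in> G then d k else 0)"]) auto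
qed

lemma lin_span_L2: "(\<And>k. k \<in> I \<Longrightarrow> f k \<in> L2) \<Longrightarrow> g \<in> lin_span f I \<Longrightarrow> g \<in> L2"
  by (erule lin_spanE) (simp add: L2_sum subset_iff)

lemma lin_span_generator:
  assumes "k \<in> I" shows "f k \<in> lin_span f I"
  using assms by (intro lin_spanI[of "{k}" _ _ "\<lambda>k. 1"]) auto

lemma closed_span_on_generator:
  assumes "k \<in> I" "f k \<in> L2" shows "f k \<in> closed_span_on f I"
  unfolding closed_span_on_def using lin_span_generator[of k I f] assms L2_norm_zero
  by (auto intro!: bexI[of _ "f k"])

lemma closed_subspace_closed_span_on:
  assumes f: "\<And>k. k \<in> I \<Longrightarrow> f k \<in> L2"
  shows "closed_subspace_L2 (closed_span_on f I)"
proof -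
  let ?V = "closed_span_on f I"
  have VL: "?V \<subseteq> L2" by (auto simp: closed_span_on_def)
  have approx: "\<exists>h\<in>lin_span f I. L2_norm (\<lambda>t. g t - h t) < \<epsilon>" if "g \<in> ?V" "\<epsilon> > 0" for g \<epsilon>
    using that by (auto simp: closed_span_on_def)
  note sL = lin_span_L2[OF f]
  have zero: "(\<lambda>t. 0) \<in> lin_span f I"
    by (rule lin_spanI[of "{}"]) auto
  have "(\<lambda>t. g t + h t) \<in> ?V" if g: "g \<in> ?V" and h: "h \<in> ?V" for g h
  proof -
    have L: "g \<in> L2" "h \<in> L2" using g h VL by auto
    have "\<exists>x\<in>lin_span f I. L2_norm (\<lambda>t. g t + h t - x t) < \<epsilon>" if "\<epsilon> > 0" for \<epsilon>
    proof -
      obtain x y where x: "x \<in> lin_span f I" "L2_norm (\<lambda>t. g t - x t) < \<epsilon> / 2"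
        and y: "y \<in> lin_span f I" "L2_norm (\<lambda>t. h t - y t) < \<epsilon> / 2"
        using approx[OF g, of "\<epsilon> / 2"] approx[OF h, of "\<epsilon> / 2"] \<open>\<epsilon> > 0\<close> by auto
      have "L2_norm (\<lambda>t. g t + h t - (x t + y t)) \<le> L2_norm (\<lambda>t. g t - x t) + L2_norm (\<lambda>t. h t - y t)"
        using L2_norm_triangle[OF L2_diff[OF L(1) sL[OF _ x(1)]] L2_diff[OF L(2) sL[OF _ y(1)]]]
        by (simp add: algebra_simps)
      then show ?thesis
        using x y lin_span_add[OF x(1) y(1)] by (intro bexI[of _ "\<lambda>t. x t + y t"]) auto
    qed
    then show ?thesis using L2_add[OF L] by (simp add: closed_span_on_def)
  qed
  moreover have "(\<lambda>t. c * g t) \<in> ?V" if g: "g \<in> ?V" for g c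
  proof -
    have L: "g \<in> L2" using g VL by auto
    have "\<exists>x\<in>lin_span f I. L2_norm (\<lambda>t. c * g t - x t) < \<epsilon>" if "\<epsilon> > 0" for \<epsilon>
    proof -
      \<comment> \<open>The summand 1 covers \<open>c = 0\<close>.\<close>
      have pos: "\<epsilon> / (cmod c + 1) > 0"
        using \<open>\<epsilon> > 0\<close> by (simp add: add_nonneg_pos)
      obtain x where x: "x \<in> lin_span f I" "L2_norm (\<lambda>t. g t - x t) < \<epsilon> / (cmod c + 1)"
        using approx[OF g pos] by auto
      have "L2_norm (\<lambda>t. c * g t - c * x t) = cmod c * L2_norm (\<lambda>t. g t - x t)"
        unfolding L2_norm_scale[symmetric] by (simp add: right_diff_distrib)
      also have "\<dots> \<le> (cmod c + 1) * L2_norm (\<lambda>t. g t - x t)"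
        by (intro mult_right_mono L2_norm_nonneg) simp
      also have "\<dots> < \<epsilon>"
        using x(2) pos_less_divide_eq[of "cmod c + 1" "L2_norm (\<lambda>t. g t - x t)" \<epsilon>]
        by (simp add: add_nonneg_pos mult.commute)
      finally show ?thesis
        using lin_span_scale[OF x(1), of c] by (intro bexI[of _ "\<lambda>t. c * x t"])
    qed
    then show ?thesis using L2_scale[OF L] by (simp add: closed_span_on_def)
  qed
  moreover have "g \<in> ?V"
    if g: "g \<in> L2" and lim: "\<forall>\<epsilon>>0. \<exists>h\<in>?V. L2_norm (\<lambda>t. g t - h t) < \<epsilon>" for g
  proof -
    have "\<exists>x\<in>lin_span f I. L2_norm (\<lambda>t. g t - x t) < \<epsilon>" if "\<epsilon> > 0" for \<epsilon>
    proof -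
      obtain h where h: "h \<in> ?V" "L2_norm (\<lambda>t. g t - h t) < \<epsilon> / 2"
        using lim \<open>\<epsilon> > 0\<close> half_gt_zero by blast
      obtain x where x: "x \<in> lin_span f I" "L2_norm (\<lambda>t. h t - x t) < \<epsilon> / 2"
        using approx[OF h(1), of "\<epsilon> / 2"] \<open>\<epsilon> > 0\<close> by auto
      have "L2_norm (\<lambda>t. g t - x t) < \<epsilon>"
        using L2_norm_triangle_through[OF g subsetD[OF VL h(1)] sL[OF _ x(1)]] h(2) x(2) by simp
      with x(1) show ?thesis by blast
    qed
    then show ?thesis using g by (simp add: closed_span_on_def)
  qed
  moreover have "(\<lambda>t. 0) \<in> ?V"
    using zero L2_norm_zero by (auto simp: closed_span_on_def L2_zero intro!: bexI[of _ "\<lambda>t. 0"])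
  ultimately show ?thesis
    using VL by (simp add: closed_subspace_L2_def)
qed

lemma closed_span_on_mono:
  assumes "I \<subseteq> J" shows "closed_span_on f I \<subseteq> closed_span_on f J"
proof -
  have "lin_span f I \<subseteq> lin_span f J"
    unfolding lin_span_def using assms by blast
  then show ?thesis
    unfolding closed_span_on_def by blast
qed

section \<open>Chirped shifts as isometries\<close>

lemma distr_lebesgue_shift: "distr lebesgue lebesgue (\<lambda>t::real. t - a) = lebesgue"
  using lebesgue_real_affine[of 1 "-a"] by (simp add: density_1)

lemma measurable_lebesgue_shift: "(\<lambda>t::real. t - a) \<in> lebesgue \<rightarrow>\<^sub>M lebesgue"
  using lebesgue_affine_measurable[of "\<lambda>_. 1" "-a"] by simp

lemma integral_lebesgue_shift:
  fixes f :: "real \<Rightarrow> 'a :: {banach, second_countable_topology}"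
  assumes "f \<in> borel_measurable lebesgue"
  shows "(LINT t|lebesgue. f (t - a)) = (LINT t|lebesgue. f t)"
  using integral_distr[OF measurable_lebesgue_shift assms] by (simp add: distr_lebesgue_shift)

lemma integrable_lebesgue_shift:
  fixes f :: "real \<Rightarrow> 'a :: {banach, second_countable_topology}"
  assumes "integrable lebesgue f"
  shows "integrable lebesgue (\<lambda>t. f (t - a))"
  by (rule integrable_distr[OF measurable_lebesgue_shift]) (simp add: distr_lebesgue_shift assms)

lemma chirp_shift_cis:
  "chirp_shift \<alpha> f n t = f (t - of_int n) * cis (- ((t * of_int n + (of_int n)\<^sup>2) * cot \<alpha>))"
  by (simp add: chirp_shift_def cis_conv_exp)

lemma chirp_shift_0: "chirp_shift \<alpha> f 0 = f"
  by (simp add: chirp_shift_cis fun_eq_iff)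

lemma norm_chirp_shift: "cmod (chirp_shift \<alpha> f n t) = cmod (f (t - of_int n))"
  by (simp add: chirp_shift_cis norm_mult)

lemma chirp_shift_L2:
  assumes "f \<in> L2" shows "chirp_shift \<alpha> f n \<in> L2"
proof -
  have "(\<lambda>t. f (t - of_int n)) \<in> borel_measurable lebesgue"
    by (rule measurable_compose[OF measurable_lebesgue_shift L2_measurable[OF assms]])
  moreover have "(\<lambda>t. cis (- ((t * of_int n + (of_int n)\<^sup>2) * cot \<alpha>))) \<in> borel_measurable lebesgue"
    by (rule measurable_completion, simp, rule borel_measurable_continuous_onI) (intro continuous_intros)
  ultimately have "chirp_shift \<alpha> f n \<in> borel_measurable lebesgue"
    unfolding chirp_shift_cis[abs_def] by (rule borel_measurable_times)
  moreover have "integrable lebesgue (\<lambda>t. (cmod (chirp_shift \<alpha> f n t))\<^sup>2)"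
    unfolding norm_chirp_shift
    by (rule integrable_lebesgue_shift[OF L2_integrable[OF assms]])
  ultimately show ?thesis by (simp add: L2_def)
qed

text \<open>The unimodular phase cancels against its conjugate, and Lebesgue measure is invariant
  under translation.\<close>

lemma L2_inner_chirp_shift:
  assumes "f \<in> L2" "g \<in> L2"
  shows "L2_inner (chirp_shift \<alpha> f n) (chirp_shift \<alpha> g n) = L2_inner f g"
proof -
  have "chirp_shift \<alpha> f n t * cnj (chirp_shift \<alpha> g n t) = f (t - of_int n) * cnj (g (t - of_int n))" for t
    by (simp add: chirp_shift_cis cis_cnj cis_mult mult_ac mult.left_commute[of _ "cis _"])
  then show ?thesis
    unfolding L2_inner_def
    using integral_lebesgue_shift[OF borel_measurable_integrable[OF L2_integrable_mult[OF assms]]]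
    by simp
qed

lemma L2_norm_chirp_shift:
  assumes "f \<in> L2" shows "L2_norm (chirp_shift \<alpha> f n) = L2_norm f"
  unfolding L2_norm_def norm_chirp_shift
  using integral_lebesgue_shift[OF borel_measurable_integrable[OF L2_integrable[OF assms]]] by simp

lemma chirp_shift_add:
  "chirp_shift \<alpha> (\<lambda>t. f t + g t) n = (\<lambda>t. chirp_shift \<alpha> f n t + chirp_shift \<alpha> g n t)"
  by (simp add: chirp_shift_def fun_eq_iff distrib_right)

lemma chirp_shift_scale:
  "chirp_shift \<alpha> (\<lambda>t. c * f t) n = (\<lambda>t. c * chirp_shift \<alpha> f n t)"
  by (simp add: chirp_shift_def fun_eq_iff mult.assoc)

text \<open>
  The phase is symmetric in \<open>m\<close> and \<open>n\<close>: up to unimodular constants, the chirped shifts are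
  the powers of one unitary operator.
\<close>

lemma chirp_shift_comp:
  "chirp_shift \<alpha> f (m + n) =
    (\<lambda>t. cis (- 3 * of_int m * of_int n * cot \<alpha>) * chirp_shift \<alpha> (chirp_shift \<alpha> f m) n t)"
proof
  fix t :: real
  let ?a = "- 3 * of_int m * of_int n * cot \<alpha>"
  let ?b = "- (((t - of_int n) * of_int m + (of_int m)\<^sup>2) * cot \<alpha>)"
  let ?c = "- ((t * of_int n + (of_int n)\<^sup>2) * cot \<alpha>)"
  have "- ((t * of_int (m + n) + (of_int (m + n))\<^sup>2) * cot \<alpha>) = ?a + (?b + ?c)"
    by (simp add: algebra_simps power2_eq_square)
  then have "cis (- ((t * of_int (m + n) + (of_int (m + n))\<^sup>2) * cot \<alpha>)) = cis ?a * (cis ?b * cis ?c)"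
    by (simp only: cis_mult)
  moreover have "t - of_int (m + n) = t - of_int n - of_int m"
    by simp
  ultimately show "chirp_shift \<alpha> f (m + n) t = cis ?a * chirp_shift \<alpha> (chirp_shift \<alpha> f m) n t"
    unfolding chirp_shift_cis by (simp only: mult_ac)
qed

text \<open>The elements that the shift by \<open>n\<close> sends into \<open>H\<close> form a
  closed subspace, because the shift is a linear isometry; so it suffices that the generators are
  sent there.\<close>

lemma chirp_shift_closed_span_on:
  assumes \<phi>: "\<phi> \<in> L2" and H: "closed_subspace_L2 H"
    and I: "\<And>k. k \<in> I \<Longrightarrow> chirp_shift \<alpha> \<phi> (k + n) \<in> H"
    and x: "x \<in> closed_span_on (chirp_shift \<alpha> \<phi>) I"
  shows "chirp_shift \<alpha> x n \<in> H"
proof -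
  have S: "closed_subspace_L2 {x \<in> L2. chirp_shift \<alpha> x n \<in> H}"
    by (rule closed_subspace_preimage[OF H, where K = 1])
       (simp_all add: chirp_shift_L2 chirp_shift_add chirp_shift_scale L2_norm_chirp_shift)
  have "chirp_shift \<alpha> \<phi> k \<in> {x \<in> L2. chirp_shift \<alpha> x n \<in> H}" if "k \<in> I" for k
  proof -
    let ?w = "cis (- 3 * of_int k * of_int n * cot \<alpha>)"
    \<comment> \<open>The conjugate of the constant in \<open>chirp_shift_comp\<close> undoes it,
      turning the shift by \<open>k + n\<close> into the composition of the two shifts.\<close>
    have "(\<lambda>t. cnj ?w * chirp_shift \<alpha> \<phi> (k + n) t) \<in> H"
      by (intro closed_subspace_scale[OF H] I that)
    also have "(\<lambda>t. cnj ?w * chirp_shift \<alpha> \<phi> (k + n) t) = chirp_shift \<alpha> (chirp_shift \<alpha> \<phi> k) n"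
      unfolding chirp_shift_comp mult.assoc[symmetric] cis_cnj cis_mult by simp
    finally show ?thesis by (simp add: chirp_shift_L2 \<phi>)
  qed
  from closed_span_on_minimal[OF S, of I "chirp_shift \<alpha> \<phi>", OF this] x show ?thesis
    by (auto dest: subsetD)
qed

section \<open>Riesz bounds on finite sums and on tails\<close>

text \<open>A finite combination is a square-summable expansion once its coefficients are padded
  with zeros. Only these finite bounds enter the rest of the argument.\<close>

lemma Riesz_basis_finite_bounds:
  assumes "Riesz_basis f H"
  obtains C\<^sub>1 C\<^sub>2 where "0 < C\<^sub>1" "C\<^sub>1 \<le> C\<^sub>2"
    "\<And>F c. finite F \<Longrightarrow> C\<^sub>1 * (\<Sum>k\<in>F. (cmod (c k))\<^sup>2) \<le> (L2_norm (\<lambda>t. \<Sum>k\<in>F. c k * f k t))\<^sup>2"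
    "\<And>F c. finite F \<Longrightarrow> (L2_norm (\<lambda>t. \<Sum>k\<in>F. c k * f k t))\<^sup>2 \<le> C\<^sub>2 * (\<Sum>k\<in>F. (cmod (c k))\<^sup>2)"
proof -
  have H: "closed_subspace_L2 H" and fH: "\<And>k. f k \<in> H"
    using assms by (auto simp: Riesz_basis_def)
  obtain C\<^sub>1 C\<^sub>2 where C: "0 < C\<^sub>1" "C\<^sub>1 \<le> C\<^sub>2"
    and bounds: "\<forall>g\<in>H. \<forall>a\<in>l2. has_sum_L2 (\<lambda>k t. a k * f k t) g \<longrightarrow>
           C\<^sub>1 * (\<Sum>\<^sub>\<infinity>k. (cmod (a k))\<^sup>2) \<le> (L2_norm g)\<^sup>2 \<and>
           (L2_norm g)\<^sup>2 \<le> C\<^sub>2 * (\<Sum>\<^sub>\<infinity>k. (cmod (a k))\<^sup>2)"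
    using assms unfolding Riesz_basis_def by (elim conjE exE) (rule that)
  have "C\<^sub>1 * (\<Sum>k\<in>F. (cmod (c k))\<^sup>2) \<le> (L2_norm (\<lambda>t. \<Sum>k\<in>F. c k * f k t))\<^sup>2 \<and>
      (L2_norm (\<lambda>t. \<Sum>k\<in>F. c k * f k t))\<^sup>2 \<le> C\<^sub>2 * (\<Sum>k\<in>F. (cmod (c k))\<^sup>2)"
    if F: "finite F" for F c
  proof -
    define a where "a k = (if k \<in> F then c k else 0)" for k
    have "((\<lambda>k. (cmod (a k))\<^sup>2) has_sum (\<Sum>k\<in>F. (cmod (a k))\<^sup>2)) F"
      using F by (rule has_sum_finite)
    then have sum: "((\<lambda>k. (cmod (a k))\<^sup>2) has_sum (\<Sum>k\<in>F. (cmod (a k))\<^sup>2)) UNIV"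
      by (rule has_sum_cong_neutral[THEN iffD1, rotated -1]) (auto simp: a_def)
    then have "a \<in> l2"
      by (auto simp: l2_def summable_on_def)
    moreover have "has_sum_L2 (\<lambda>k t. a k * f k t) (\<lambda>t. \<Sum>k\<in>F. c k * f k t)"
      unfolding has_sum_L2_def
    proof (rule tendsto_eventually)
      \<comment> \<open>The net of partial sums is constant from \<open>F\<close> on.\<close>
      have "(\<Sum>k\<in>G. a k * f k t) = (\<Sum>k\<in>F. c k * f k t)" if "finite G" "F \<subseteq> G" for G t
        using that by (intro sum.mono_neutral_cong_right) (auto simp: a_def)
      then show "\<forall>\<^sub>F G in finite_subsets_at_top UNIV.
          L2_norm (\<lambda>t. (\<Sum>k\<in>F. c k * f k t) - (\<Sum>k\<in>G. a k * f k t)) = 0"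
        unfolding eventually_finite_subsets_at_top
        using F by (auto simp: L2_norm_zero intro!: exI[of _ F])
    qed
    moreover have "(\<Sum>\<^sub>\<infinity>k. (cmod (a k))\<^sup>2) = (\<Sum>k\<in>F. (cmod (c k))\<^sup>2)"
      unfolding infsumI[OF sum] by (auto simp: a_def)
    ultimately show ?thesis
      using bounds[rule_format, of "\<lambda>t. \<Sum>k\<in>F. c k * f k t" a] closed_subspace_sum[OF H, of F f c] fH
      by simp
  qed
  with C show ?thesis by (intro that[of C\<^sub>1 C\<^sub>2]) auto
qed

text \<open>The difference is a single combination over the union, with coefficients
  \<open>c\<close> on \<open>F\<close> and \<open>- d\<close> on \<open>G\<close>. The lower bound
  applies to it, and the terms from \<open>G\<close> may be dropped.\<close>

lemma lower_bound_disjoint: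
  fixes f :: "int \<Rightarrow> real \<Rightarrow> complex"
  assumes lower: "\<And>F c. finite F \<Longrightarrow>
      C * (\<Sum>k\<in>F. (cmod (c k))\<^sup>2) \<le> (L2_norm (\<lambda>t. \<Sum>k\<in>F. c k * f k t))\<^sup>2"
    and C: "0 < C" and F: "finite F" "finite G" "F \<inter> G = {}"
  shows "C * (\<Sum>k\<in>F. (cmod (c k))\<^sup>2) \<le>
    (L2_norm (\<lambda>t. (\<Sum>k\<in>F. c k * f k t) - (\<Sum>k\<in>G. d k * f k t)))\<^sup>2"
proof -
  let ?e = "\<lambda>k. if k \<in> F then c k else - d k"
  have "(\<Sum>k\<in>F. (cmod (c k))\<^sup>2) = (\<Sum>k\<in>F. (cmod (?e k))\<^sup>2)"
    by (rule sum.cong) auto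
  also have "\<dots> \<le> (\<Sum>k\<in>F \<union> G. (cmod (?e k))\<^sup>2)"
    using F by (intro sum_mono2) auto
  finally have "C * (\<Sum>k\<in>F. (cmod (c k))\<^sup>2) \<le> C * (\<Sum>k\<in>F \<union> G. (cmod (?e k))\<^sup>2)"
    using C by simp
  also have "\<dots> \<le> (L2_norm (\<lambda>t. \<Sum>k\<in>F \<union> G. ?e k * f k t))\<^sup>2"
    using F by (intro lower) auto
  also have "(\<lambda>t. \<Sum>k\<in>F \<union> G. ?e k * f k t) = (\<lambda>t. (\<Sum>k\<in>F. c k * f k t) - (\<Sum>k\<in>G. d k * f k t))"
  proof
    fix t show "(\<Sum>k\<in>F \<union> G. ?e k * f k t) = (\<Sum>k\<in>F. c k * f k t) - (\<Sum>k\<in>G. d k * f k t)"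
      using sum_disjoint_if[OF F, of c "\<lambda>k. - d k" f t] by (simp add: sum_negf)
  qed
  finally show ?thesis .
qed

text \<open>A combination that avoids the index \<open>j\<close> stays at distance at least
  \<open>sqrt C\<close> from \<open>f j\<close>.\<close>

lemma generator_notin_closed_span_on:
  assumes lower: "\<And>F c. finite F \<Longrightarrow>
      C * (\<Sum>k\<in>F. (cmod (c k))\<^sup>2) \<le> (L2_norm (\<lambda>t. \<Sum>k\<in>F. c k * f k t))\<^sup>2"
    and C: "0 < C" and j: "j \<notin> I"
  shows "f j \<notin> closed_span_on f I"
proof
  assume "f j \<in> closed_span_on f I"
  then obtain G d where G: "finite G" "G \<subseteq> I"
    and near: "L2_norm (\<lambda>t. f j t - (\<Sum>k\<in>G. d k * f k t)) < sqrt C"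
    using C unfolding closed_span_on_def bex_lin_span by (auto dest: spec[of _ "sqrt C"])
  have "C * (\<Sum>k\<in>{j}. (cmod 1)\<^sup>2) \<le> (L2_norm (\<lambda>t. (\<Sum>k\<in>{j}. 1 * f k t) - (\<Sum>k\<in>G. d k * f k t)))\<^sup>2"
    using G j by (intro lower_bound_disjoint[where c = "\<lambda>_. 1", OF lower C]) auto
  then have "sqrt C \<le> L2_norm (\<lambda>t. f j t - (\<Sum>k\<in>G. d k * f k t))"
    by (intro real_le_lsqrt) (simp_all add: L2_norm_nonneg)
  with near show False by simp
qed

text \<open>Approximate \<open>r\<close> by a finite combination, and again by one supported beyond
  it. The two are close to each other and have disjoint supports, so the lower bound makes the
  coefficients of the first small. The upper bound then makes the first combination small, and with
  it \<open>r\<close>.\<close>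

lemma tail_intersection_trivial:
  assumes f: "\<And>k. f k \<in> L2" and C: "0 < C\<^sub>1"
    and lower: "\<And>F c. finite F \<Longrightarrow>
      C\<^sub>1 * (\<Sum>k\<in>F. (cmod (c k))\<^sup>2) \<le> (L2_norm (\<lambda>t. \<Sum>k\<in>F. c k * f k t))\<^sup>2"
    and upper: "\<And>F c. finite F \<Longrightarrow>
      (L2_norm (\<lambda>t. \<Sum>k\<in>F. c k * f k t))\<^sup>2 \<le> C\<^sub>2 * (\<Sum>k\<in>F. (cmod (c k))\<^sup>2)"
    and r: "\<And>n::nat. r \<in> closed_span_on f {int n..}"
  shows "L2_norm r = 0"
proof (rule ccontr)
  assume "L2_norm r \<noteq> 0"
  then have pos: "L2_norm r > 0" using L2_norm_nonneg[of r] by simp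
  \<comment> \<open>Chosen so that approximation within \<epsilon> leads to
    \<open>L2_norm r < K * \<epsilon>\<close>, against the definition of \<epsilon>. The absolute
    value is there because no sign of \<open>C\<^sub>2\<close> is given.\<close>
  define K where "K = 1 + 2 * sqrt (\<bar>C\<^sub>2\<bar> / C\<^sub>1)"
  have K: "K > 0" using C by (simp add: K_def add_pos_nonneg)
  define \<epsilon> where "\<epsilon> = L2_norm r / K"
  have \<epsilon>: "\<epsilon> > 0" using pos K by (simp add: \<epsilon>_def)
  have approx: "\<exists>F c. finite F \<and> F \<subseteq> {int n..} \<and> L2_norm (\<lambda>t. r t - (\<Sum>k\<in>F. c k * f k t)) < \<epsilon>" for n
    using r[of n] \<epsilon> unfolding closed_span_on_def bex_lin_span by blast
  have rL: "r \<in> L2" using r[of 0] by (simp add: closed_span_on_def)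
  obtain F c where F: "finite F" and near: "L2_norm (\<lambda>t. r t - (\<Sum>k\<in>F. c k * f k t)) < \<epsilon>"
    using approx by blast
  define h where "h t = (\<Sum>k\<in>F. c k * f k t)" for t
  obtain b where b: "\<And>k. k \<in> F \<Longrightarrow> k \<le> b"
    using bdd_above_finite[OF F] by (auto simp: bdd_above_def)
  \<comment> \<open>If \<open>b + 1\<close> is negative, \<open>nat\<close> truncates it to 0, and
    the tail still starts beyond \<open>b\<close>.\<close>
  obtain G d where G: "finite G" "G \<subseteq> {int (nat (b + 1))..}"
    and near': "L2_norm (\<lambda>t. r t - (\<Sum>k\<in>G. d k * f k t)) < \<epsilon>"
    using approx by blast
  have "b + 1 \<le> k" if "k \<in> G" for k
  proof -
    have "int (nat (b + 1)) \<le> k" using that G(2) by blast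
    then show ?thesis by linarith
  qed
  then have disj: "F \<inter> G = {}"
    using b by fastforce
  define h' where "h' t = (\<Sum>k\<in>G. d k * f k t)" for t
  have hL: "h \<in> L2" "h' \<in> L2"
    unfolding h_def[abs_def] h'_def[abs_def] using f by (auto intro: L2_sum)
  have "L2_norm (\<lambda>t. h t - h' t) \<le> L2_norm (\<lambda>t. h t - r t) + L2_norm (\<lambda>t. r t - h' t)"
    by (rule L2_norm_triangle_through[OF hL(1) rL hL(2)])
  also have "\<dots> \<le> 2 * \<epsilon>"
    using near near' L2_norm_minus_commute[of h r] by (simp add: h_def h'_def)
  finally have "(L2_norm (\<lambda>t. h t - h' t))\<^sup>2 \<le> (2 * \<epsilon>)\<^sup>2"
    by (intro power_mono L2_norm_nonneg)
  then have "C\<^sub>1 * (\<Sum>k\<in>F. (cmod (c k))\<^sup>2) \<le> (2 * \<epsilon>)\<^sup>2"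
    using lower_bound_disjoint[OF lower C F G(1) disj, of c d] by (simp add: h_def h'_def)
  then have "(\<Sum>k\<in>F. (cmod (c k))\<^sup>2) \<le> (2 * \<epsilon>)\<^sup>2 / C\<^sub>1"
    using C by (simp add: pos_le_divide_eq mult.commute)
  then have "\<bar>C\<^sub>2\<bar> * (\<Sum>k\<in>F. (cmod (c k))\<^sup>2) \<le> \<bar>C\<^sub>2\<bar> * ((2 * \<epsilon>)\<^sup>2 / C\<^sub>1)"
    by (intro mult_left_mono) auto
  moreover have "C\<^sub>2 * (\<Sum>k\<in>F. (cmod (c k))\<^sup>2) \<le> \<bar>C\<^sub>2\<bar> * (\<Sum>k\<in>F. (cmod (c k))\<^sup>2)"
    by (intro mult_right_mono sum_nonneg) auto
  ultimately have "(L2_norm h)\<^sup>2 \<le> (\<bar>C\<^sub>2\<bar> / C\<^sub>1) * (2 * \<epsilon>)\<^sup>2"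
    using upper[OF F, of c] by (simp add: h_def[abs_def])
  then have "L2_norm h \<le> sqrt ((\<bar>C\<^sub>2\<bar> / C\<^sub>1) * (2 * \<epsilon>)\<^sup>2)"
    by (rule real_le_rsqrt)
  also have "\<dots> = sqrt (\<bar>C\<^sub>2\<bar> / C\<^sub>1) * (2 * \<epsilon>)"
    using \<epsilon> by (simp only: real_sqrt_mult real_sqrt_abs)
  finally have "L2_norm h \<le> sqrt (\<bar>C\<^sub>2\<bar> / C\<^sub>1) * (2 * \<epsilon>)" .
  moreover have "L2_norm r \<le> L2_norm (\<lambda>t. r t - h t) + L2_norm h"
    using L2_norm_triangle[OF L2_diff[OF rL hL(1)] hL(1)] by simp
  ultimately have "L2_norm r < K * \<epsilon>"
    using near by (simp add: h_def K_def algebra_simps)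
  then show False
    using K by (simp add: \<epsilon>_def)
qed

section \<open>Wold decomposition of the closed span\<close>

theorem theorem3p5:
  fixes \<alpha> :: real and \<phi> :: "real \<Rightarrow> complex"
  assumes "\<not> (\<exists>m::int. \<alpha> = of_int m * pi)"
    and "\<phi> \<in> L2"
    and "Riesz_basis (chirp_shift \<alpha> \<phi>) (closed_span_L2 (chirp_shift \<alpha> \<phi>))"
  shows "\<exists>\<psi>. orthonormal_basis_L2 (chirp_shift \<alpha> \<psi>) (closed_span_L2 (chirp_shift \<alpha> \<phi>))"
proof -
  note \<phi> = assms(2)
  let ?f = "chirp_shift \<alpha> \<phi>"
  obtain C\<^sub>1 C\<^sub>2 where C: "0 < C\<^sub>1"
    and lower: "\<And>F c. finite F \<Longrightarrow>
      C\<^sub>1 * (\<Sum>k\<in>F. (cmod (c k))\<^sup>2) \<le> (L2_norm (\<lambda>t. \<Sum>k\<in>F. c k * ?f k t))\<^sup>2"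
    and upper: "\<And>F c. finite F \<Longrightarrow>
      (L2_norm (\<lambda>t. \<Sum>k\<in>F. c k * ?f k t))\<^sup>2 \<le> C\<^sub>2 * (\<Sum>k\<in>F. (cmod (c k))\<^sup>2)"
    by (rule Riesz_basis_finite_bounds[OF assms(3)]) (rule that)
  define V where "V n = closed_span_on ?f {n..}" for n
  have V: "closed_subspace_L2 (V n)" for n
    unfolding V_def by (intro closed_subspace_closed_span_on chirp_shift_L2 \<phi>)
  have V_mono: "V n \<subseteq> V m" if "m \<le> n" for m n
    unfolding V_def using that by (intro closed_span_on_mono) auto
  have f_V: "?f k \<in> V n" if "n \<le> k" for k n
    unfolding V_def using that by (intro closed_span_on_generator chirp_shift_L2 \<phi>) auto
  have V_L2: "x \<in> L2" if "x \<in> V n" for x n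
    using closed_subspace_subset[OF V that] .
  have V_shift: "chirp_shift \<alpha> x n \<in> V (m + n)" if "x \<in> V m" for x m n
    by (rule chirp_shift_closed_span_on[OF \<phi> V _ that[unfolded V_def]]) (auto intro: f_V)

  obtain p where p: "p \<in> V 1" and p_orth: "\<And>h. h \<in> V 1 \<Longrightarrow> L2_inner (\<lambda>t. \<phi> t - p t) h = 0"
    using projection_L2[OF V \<phi>] by blast
  define \<xi> where "\<xi> t = \<phi> t - p t" for t
  have "\<phi> \<in> V 0"
    using f_V[of 0 0] by (simp add: chirp_shift_0)
  then have \<xi>_V: "\<xi> \<in> V 0"
    unfolding \<xi>_def[abs_def] using p V_mono[of 0 1] by (intro closed_subspace_diff[OF V]) auto
  have "\<phi> \<notin> V 1"
    using generator_notin_closed_span_on[of C\<^sub>1 ?f 0 "{1..}", OF lower C] by (simp add: chirp_shift_0 V_def)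
  define c where "c = L2_norm \<xi>"
  \<comment> \<open>If the residual had norm zero, \<open>p\<close> would approximate \<phi> to any
    accuracy, and closedness would put \<phi> into \<open>V 1\<close>.\<close>
  have "c \<noteq> 0"
  proof
    assume "c = 0"
    then have "\<phi> \<in> V 1"
      using p by (intro closed_subspace_closed[OF V \<phi>] bexI[of _ p]) (simp_all add: c_def \<xi>_def[abs_def])
    with \<open>\<phi> \<notin> V 1\<close> show False ..
  qed
  then have c: "c > 0" using L2_norm_nonneg[of \<xi>] by (simp add: c_def)
  define \<psi> where "\<psi> t = of_real (1 / c) * \<xi> t" for t
  have \<psi>_V: "\<psi> \<in> V 0"
    unfolding \<psi>_def[abs_def] by (intro closed_subspace_scale[OF V] \<xi>_V)
  note \<psi>_L2 = V_L2[OF \<psi>_V]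
  have \<psi>_orth: "L2_inner \<psi> h = 0" if "h \<in> V 1" for h
    using p_orth[OF that] unfolding \<psi>_def[abs_def] \<xi>_def[abs_def] L2_inner_scale_left by simp
  have "L2_norm \<psi> = 1"
    unfolding \<psi>_def[abs_def] L2_norm_scale using c by (simp add: c_def[symmetric] norm_divide)
  then have \<psi>_unit: "L2_inner \<psi> \<psi> = 1"
    by (simp add: L2_inner_self)
  have \<phi>_eq: "\<phi> t = p t + of_real c * \<psi> t" for t
    using c by (simp add: \<psi>_def \<xi>_def)

  let ?e = "chirp_shift \<alpha> \<psi>"
  have e_V: "?e n \<in> V n" for n
    using V_shift[OF \<psi>_V, of n] by simp
  note e_L2 = V_L2[OF e_V]
  \<comment> \<open>Split the shift by \<open>k\<close> as \<open>k - n\<close> followed by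
    \<open>n\<close>. The first one moves \<open>V 0\<close> into \<open>V 1\<close>, which is
    orthogonal to \<psi>; the second is an isometry and acts on both arguments. The case of \<psi>
    gives orthogonality of the system, the case of \<phi> is used for \<open>V_step\<close>.\<close>
  have inner_e: "L2_inner (chirp_shift \<alpha> x k) (?e n) = 0"
    if "n < k" "x \<in> V 0" for x k n
  proof -
    have "x \<in> L2" using V_L2[OF that(2)] .
    have "chirp_shift \<alpha> x (k - n) \<in> V 1"
      using V_shift[OF that(2), of "k - n"] V_mono[of 1 "k - n"] that(1) by auto
    then have "L2_inner (chirp_shift \<alpha> x (k - n)) \<psi> = 0"
      using \<psi>_orth L2_inner_commute[of "chirp_shift \<alpha> x (k - n)" \<psi>] by simp
    then have "L2_inner (chirp_shift \<alpha> (chirp_shift \<alpha> x (k - n)) n) (?e n) = 0"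
      using L2_inner_chirp_shift[OF chirp_shift_L2[OF \<open>x \<in> L2\<close>] \<psi>_L2] by simp
    then show ?thesis
      using chirp_shift_comp[of \<alpha> x "k - n" n] by (simp add: L2_inner_scale_left)
  qed
  have orthonormal: "L2_inner (?e j) (?e k) = (if j = k then 1 else 0)" for j k
  proof (cases j k rule: linorder_cases)
    case less
    then show ?thesis
      using inner_e[OF less \<psi>_V] L2_inner_commute[of "?e j" "?e k"] by simp
  next
    case equal
    then show ?thesis
      using L2_inner_chirp_shift[OF \<psi>_L2 \<psi>_L2] \<psi>_unit by simp
  next
    case greater
    then show ?thesis
      using inner_e[OF greater \<psi>_V] by simp
  qed

  have V_step: "x \<in> V (n + 1)" if x: "x \<in> V n" and orth: "L2_inner x (?e n) = 0" for x n
  proof -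
    \<comment> \<open>\<open>T\<close> removes the component along \<open>?e n\<close>. It is
      bounded and takes the generators of \<open>V n\<close> into \<open>V (n + 1)\<close>, hence
      all of \<open>V n\<close>; it fixes \<open>x\<close> by orthogonality.\<close>
    define T where "T y = (\<lambda>t. y t - L2_inner y (?e n) * ?e n t)" for y
    have norm_e: "L2_norm (?e n) = 1"
      using L2_norm_chirp_shift[OF \<psi>_L2] \<open>L2_norm \<psi> = 1\<close> by simp
    have "closed_subspace_L2 {y \<in> L2. T y \<in> V (n + 1)}"
    proof (rule closed_subspace_preimage[OF V, where K = 2])
      fix y assume y: "y \<in> L2"
      show "T y \<in> L2"
        unfolding T_def by (intro L2_diff L2_scale y e_L2)
      show "T (\<lambda>t. a * y t) = (\<lambda>t. a * T y t)" for a
        by (simp add: T_def L2_inner_scale_left algebra_simps)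
      have "L2_norm (T y) \<le> L2_norm y + cmod (L2_inner y (?e n))"
        using L2_norm_triangle_diff[OF y L2_scale[OF e_L2[of n]], of "L2_inner y (?e n)"]
        by (simp add: T_def L2_norm_scale norm_e)
      then show "L2_norm (T y) \<le> 2 * L2_norm y"
        using Cauchy_Schwarz_L2[OF y e_L2[of n]] norm_e by simp
      fix z assume z: "z \<in> L2"
      show "T (\<lambda>t. y t + z t) = (\<lambda>t. T y t + T z t)"
        by (simp add: T_def L2_inner_add_left[OF y z e_L2] algebra_simps)
    qed
    moreover have "?f k \<in> {y \<in> L2. T y \<in> V (n + 1)}" if "k \<in> {n..}" for k
    proof (cases "k = n")
      case True
      \<comment> \<open>Since \<open>p\<close> is orthogonal to \<psi>, the coefficient of
        \<open>?f n\<close> along \<open>?e n\<close> is exactly \<open>c\<close>. Hence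
        \<open>T\<close> leaves the shift of \<open>p\<close> by \<open>n\<close>, which lies in
        \<open>V (n + 1)\<close> because \<open>p\<close> is in \<open>V 1\<close>.\<close>
      have "L2_inner \<phi> \<psi> = L2_inner p \<psi> + of_real c"
        using L2_inner_add_left[OF V_L2[OF p] L2_scale[OF \<psi>_L2] \<psi>_L2, of c]
        by (simp add: \<phi>_eq[symmetric] L2_inner_scale_left \<psi>_unit)
      then have "L2_inner (?f n) (?e n) = of_real c"
        using \<psi>_orth[OF p] L2_inner_commute[of p \<psi>] L2_inner_chirp_shift[OF \<phi> \<psi>_L2] by simp
      moreover have "?f n t = chirp_shift \<alpha> p n t + of_real c * ?e n t" for t
        using chirp_shift_add[of \<alpha> p "\<lambda>t. of_real c * \<psi> t" n] chirp_shift_scale[of \<alpha> c \<psi> n]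
        by (simp add: \<phi>_eq[symmetric])
      ultimately have "T (?f n) = chirp_shift \<alpha> p n"
        by (simp add: T_def)
      then show ?thesis
        using V_shift[OF p, of n] True by (simp add: chirp_shift_L2 \<phi> add.commute)
    next
      case False
      with that have "n < k" by simp
      then have "T (?f k) = ?f k"
        using inner_e[OF _ \<open>\<phi> \<in> V 0\<close>] by (simp add: T_def)
      then show ?thesis
        using f_V[of "n + 1" k] \<open>n < k\<close> by (simp add: chirp_shift_L2 \<phi>)
    qed
    ultimately have "V n \<subseteq> {y \<in> L2. T y \<in> V (n + 1)}"
      unfolding V_def[of n] by (rule closed_span_on_minimal)
    then have "T x \<in> V (n + 1)" using x by auto
    then show ?thesis by (simp add: T_def orth)
  qed

  \<comment> \<open>Nonnegative indices keep \<open>?W\<close> inside \<open>V 0\<close>, so the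
    residual of \<phi> starts in \<open>V 0\<close> and \<open>V_step\<close> can push it down one
    tail at a time.\<close>
  let ?W = "closed_span_on ?e {0..}"
  have W: "closed_subspace_L2 ?W"
    by (intro closed_subspace_closed_span_on e_L2)
  obtain q where q: "q \<in> ?W" and q_orth: "\<And>h. h \<in> ?W \<Longrightarrow> L2_inner (\<lambda>t. \<phi> t - q t) h = 0"
    using projection_L2[OF W \<phi>] by blast
  define r where "r t = \<phi> t - q t" for t
  have "?W \<subseteq> V 0"
    using e_V V_mono by (intro closed_span_on_minimal V) auto
  then have "r \<in> V 0"
    unfolding r_def[abs_def] using q \<open>\<phi> \<in> V 0\<close> by (intro closed_subspace_diff[OF V]) auto
  have "L2_inner r (?e (int n)) = 0" for n
    unfolding r_def[abs_def] by (intro q_orth closed_span_on_generator e_L2) simp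
  have "r \<in> V (int n)" for n
  proof (induction n)
    case 0
    show ?case using \<open>r \<in> V 0\<close> by simp
  next
    case (Suc n)
    then show ?case
      using V_step[of r "int n"] \<open>\<And>n. L2_inner r (?e (int n)) = 0\<close> by (simp add: add.commute)
  qed
  then have "L2_norm r = 0"
    unfolding V_def by (intro tail_intersection_trivial[OF chirp_shift_L2[OF \<phi>] C lower upper])
  \<comment> \<open>The residual is zero almost everywhere only; closedness of \<open>?W\<close>
    carries the membership from \<open>q\<close> to \<phi>.\<close>
  then have "\<phi> \<in> ?W"
    using q by (intro closed_subspace_closed[OF W \<phi>] bexI[of _ q]) (simp_all add: r_def[abs_def])

  let ?M = "closed_span_on ?e UNIV" and ?H = "closed_span_on ?f UNIV"
  have M: "closed_subspace_L2 ?M"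
    by (intro closed_subspace_closed_span_on e_L2)
  have H: "closed_subspace_L2 ?H"
    by (intro closed_subspace_closed_span_on chirp_shift_L2 \<phi>)
  \<comment> \<open>Shifting by \<open>k\<close> moves the indices \<open>{0..}\<close> to
    \<open>{k..}\<close>, which may be negative; hence the target is the span over all
    integers.\<close>
  have "?f k \<in> ?M" for k
    by (rule chirp_shift_closed_span_on[OF \<psi>_L2 M _ \<open>\<phi> \<in> ?W\<close>])
       (intro closed_span_on_generator e_L2 UNIV_I)
  then have "?H \<subseteq> ?M"
    by (intro closed_span_on_minimal[OF M])
  moreover have "?e k \<in> ?H" for k
    using e_V[of k] closed_span_on_mono[of "{k..}" UNIV ?f] by (auto simp: V_def)
  then have "?M \<subseteq> ?H"
    by (intro closed_span_on_minimal[OF H])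
  ultimately have "closed_span_L2 ?e = closed_span_L2 ?f"
    by (simp add: closed_span_L2_eq)
  then show ?thesis
    unfolding orthonormal_basis_L2_def using e_L2 orthonormal by blast
qed

end
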